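(* In the setting described in the context, assume that for every $m\ge1$, every $x\in\mathcal X^{\mathbb N}$ and all $y,y'\in\mathcal Y$, $d(F_m(x;y),F_m(x;y'))\le\delta(y,y')$, and that there exist positive constants $M$ and $V_k$ such that, for every $k\in[1,n]$, $$G_{\varepsilon_k}(\varepsilon_k)\le M\ \text{ (a.s.)},\qquad \mathbb E\big[(G_{\varepsilon_k}(\varepsilon_k))^2\big]\le V_k.$$ Let $V=\sum_{k=1}^n(a_{n-k}(n-k))^2V_k$. Then, for either choice of sign and every $x>0$, $$\mathbb P(\pm S_n>x)\le H_n\Big(\frac{x}{M\,a_{n-1}(n-1)},\frac{\sqrt V}{M\,a_{n-1}(n-1)}\Big),$$ where $$H_n(x,v)=\Big\{\Big(\frac{v^2}{x+v^2}\Big)^{x+v^2}\Big(\frac{n}{n-x}\Big)^{n-x}\Big\}^{\frac{n}{n+v^2}}\mathbf 1_{\{x\le n\}}$$ with the convention $(+\infty)^0=1$ (which applies when $x=n$).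
   Context: Let $(\mathcal X,d)$ and $(\mathcal Y,\delta)$ be complete separable metric spaces. Let $(\varepsilon_i)_{i\ge1}$ be independent (not necessarily identically distributed) $\mathcal Y$-valued random variables, with $P_{\varepsilon_k}$ the law of $\varepsilon_k$. Let $(X_i)_{i\le0}$ be a deterministic sequence in $\mathcal X$. For each $m\ge1$ let $F_m:\mathcal X^{\mathbb N}\times\mathcal Y\to\mathcal X$ be measurable, and define recursively $X_m=F_m((X_{m-i})_{i\ge1};\varepsilon_m)$ for $m\ge1$. Assume there are nonnegative numbers $a_i$, $i\ge1$, with $\sum_{i\ge1}a_i<1$, such that for all $m\ge1$ and all sequences $(x_{m-i})_{i\ge1},(x'_{m-i})_{i\ge1}$ in $\mathcal X$, $$\mathbb E\big[d\big(F_m((x_{m-i})_{i\ge1};\varepsilon_m),F_m((x'_{m-i})_{i\ge1};\varepsilon_m)\big)\big]\le\sum_{i=1}^\infty a_i\,d(x_{m-i},x'_{m-i}).$$ Fix $n\ge1$ and let $f:\mathcal X^n\to\mathbb R$ satisfy $|f(x_1,\ldots,x_n)-f(x'_1,\ldots,x'_n)|\le\sum_{i=1}^n d(x_i,x'_i)$. Put $S_n=f(X_1,\ldots,X_n)-\mathbb E[f(X_1,\ldots,X_n)]$. The numbers $a_k(k)$, $k\ge0$, are defined recursively by $a_0(0)=1$ and $a_k(k)=1+a_k+\sum_{l=1}^{k-1}a_l(l)\,a_{k-l}$ for $k\ge1$ (so $a_1(1)=1+a_1$). $G_{\varepsilon_k}(y)=\int\delta(y,y')\,P_{\varepsilon_k}(dy')$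 for $y\in\mathcal Y$. *)

theory Defs
  imports "HOL-Probability.Probability"
begin

text \<open>
  The diagonal numbers \<open>a_k(k)\<close>.  Only the values \<open>a i\<close> with \<open>i \<ge> 1\<close> are used.
\<close>

fun diag_coeff :: "(nat \<Rightarrow> real) \<Rightarrow> nat \<Rightarrow> real" where
  "diag_coeff a 0 = 1"
| "diag_coeff a (Suc k) = 1 + a (Suc k) + (\<Sum>l=1..k. diag_coeff a l * a (Suc k - l))"

text \<open>
  The integral is taken in \<open>[0, \<infinity>]\<close>, since a law with infinite first moment is not excluded
  a priori.
\<close>

definition mean_dist :: "'b::polish_space measure \<Rightarrow> 'b \<Rightarrow> ennreal" where
  "mean_dist Q y = (\<integral>\<^sup>+ y'. ennreal (dist y y') \<partial>Q)"

text \<open>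
  The factor \<open>(n / (n - x)) powr (n - x)\<close> at \<open>x = n\<close> is \<open>(+\<infinity>)\<^sup>0 = 1\<close>
  by convention; in HOL the expression would evaluate to \<open>0 powr 0 = 0\<close>, hence the case distinction.
\<close>

definition H_bound :: "nat \<Rightarrow> real \<Rightarrow> real \<Rightarrow> real" where
  "H_bound n x v =
    ((v\<^sup>2 / (x + v\<^sup>2)) powr (x + v\<^sup>2) *
      (if x = real n then 1 else (real n / (real n - x)) powr (real n - x)))
      powr (real n / (real n + v\<^sup>2))
    * indicator {..real n} x"

end

theory Submission
  imports Defs "HOL-Real_Asymp.Real_Asymp"
begin

text \<open>
  Write \<open>S\<close> as a sum of martingale differences with respect to the noise. Integrating out the last
  noise variables one by one turns \<open>f\<close> into functions of the first \<open>n - j\<close> coordinates; the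
  contraction hypothesis shows that the Lipschitz constant in the last of these coordinates is
  exactly \<open>diag_coeff a j\<close>, because both satisfy the same renewal recursion. Since \<open>F m z\<close> is
  \<open>1\<close>-Lipschitz in the noise, the \<open>k\<close>-th difference is bounded by \<open>diag_coeff a (n - k)\<close> times
  \<open>G k (\<epsilon> k)\<close>.

  For a centred \<open>\<xi> \<le> 1\<close> of variance at most \<open>v\<close> and any \<open>w > 0\<close>, dominate \<open>exp (t * \<xi>)\<close> by the
  quadratic that agrees with it at \<open>1\<close> and is tangent to it at \<open>-w\<close>. The resulting bound is affine
  in \<open>v\<close>, so with \<open>w\<close> equal to the average of the variance bounds the first-order terms cancel in
  the product over all steps, and no concavity argument is needed. Chernoff's bound with the optimal
  \<open>t\<close> then gives \<open>H_bound\<close>.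
\<close>

section \<open>Exponential moments of a bounded centred variable\<close>

text \<open>The quotient \<open>(exp s - 1 - s) / s\<^sup>2\<close> increases with \<open>s\<close>,
  so its value at \<open>c\<close> serves for all \<open>s \<le> c\<close>. For
  \<open>s \<ge> 0\<close> this is read off from the power series, whose coefficients are
  nonnegative; for \<open>s < 0\<close> the quotient is at most 1/2, while at \<open>c\<close> it is
  at least 1/2.\<close>

lemma exp_le_quadratic:
  fixes s c :: real
  assumes "c > 0" "s \<le> c"
  shows "exp s \<le> 1 + s + s\<^sup>2 * ((exp c - 1 - c) / c\<^sup>2)"
proof (cases "s \<ge> 0")
  case True
  define g where "g = (\<lambda>s (k::nat). inverse (fact (k + 2)) * s ^ k :: real)"
  have summ: "summable (\<lambda>k. inverse (fact (k + 2)) * s ^ (k + 2))" for s :: real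
    using summable_iff_shift[of "\<lambda>k. inverse (fact k) * s ^ k" 2] summable_exp[of s] by simp
  have g: "summable (g s)" for s
  proof (cases "s = 0")
    case True
    then show ?thesis
      by (intro summable_finite[of "{0}"]) (auto simp: g_def)
  next
    case False
    have "summable (\<lambda>k. (inverse (fact (k + 2)) * s ^ (k + 2)) / s\<^sup>2)"
      by (intro summable_divide summ)
    then show ?thesis using False by (simp add: g_def power_add power2_eq_square mult_ac)
  qed
  have E: "exp s = 1 + s + s\<^sup>2 * suminf (g s)" for s
    unfolding exp_first_two_terms suminf_mult[OF g, symmetric] scaleR_conv_of_real
    by (simp add: g_def power_add power2_eq_square mult_ac)
  have "suminf (g s) \<le> suminf (g c)"
    using True assms by (intro suminf_le g) (auto simp: g_def intro!: mult_left_mono power_mono)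
  also have "\<dots> = (exp c - 1 - c) / c\<^sup>2"
    using E[of c] assms by simp
  finally have "s\<^sup>2 * suminf (g s) \<le> s\<^sup>2 * ((exp c - 1 - c) / c\<^sup>2)"
    by (intro mult_left_mono) auto
  then show ?thesis using E[of s] by linarith
next
  case False
  have "1 + c + c\<^sup>2 / 2 \<le> exp c"
    using assms by (intro exp_lower_Taylor_quadratic) auto
  then have "1 / 2 \<le> (exp c - 1 - c) / c\<^sup>2"
    using assms by (simp add: field_simps)
  then have *: "s\<^sup>2 * (1 / 2) \<le> s\<^sup>2 * ((exp c - 1 - c) / c\<^sup>2)"
    by (intro mult_left_mono) auto
  have "exp s \<le> 1 + s + s\<^sup>2 / 2"
  proof -
    have "\<exists>\<xi>. \<bar>\<xi>\<bar> \<le> \<bar>s\<bar> \<and> exp s = (\<Sum>m<3. s ^ m / fact m) + exp \<xi> / fact 3 * s ^ 3"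
      by (rule Maclaurin_exp_le)
    then obtain \<xi> where "exp s = (\<Sum>m<3. s ^ m / fact m) + exp \<xi> / fact 3 * s ^ 3"
      by blast
    moreover have "exp \<xi> / fact 3 * s ^ 3 \<le> 0"
      using False by (intro mult_nonneg_nonpos) (auto simp: power3_eq_cube mult_nonneg_nonpos zero_le_mult_iff mult_le_0_iff)
    moreover have "(\<Sum>m<3. s ^ m / fact m) = 1 + s + s\<^sup>2 / 2"
      by (simp add: numeral_3_eq_3 power2_eq_square)
    ultimately show ?thesis by linarith
  qed
  with * show ?thesis by linarith
qed

text \<open>
  The moment generating function of the centred law on \<open>{-w, 1}\<close>, whose variance is \<open>w\<close>.
\<close>

definition two_point_mgf :: "real \<Rightarrow> real \<Rightarrow> real" where
  "two_point_mgf t w = (exp (- t * w) + w * exp t) / (1 + w)"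

text \<open>
  The second-order coefficient of the quadratic that agrees with \<open>\<lambda>z. exp (t * z)\<close> at \<open>1\<close> and is
  tangent to it at \<open>-w\<close>.
\<close>

definition mgf_slope :: "real \<Rightarrow> real \<Rightarrow> real" where
  "mgf_slope t w = exp (- t * w) * (exp (t * (1 + w)) - 1 - t * (1 + w)) / (1 + w)\<^sup>2"

lemma two_point_mgf_pos: "w \<ge> 0 \<Longrightarrow> two_point_mgf t w > 0"
  by (auto simp: two_point_mgf_def intro!: divide_pos_pos add_pos_nonneg)

text \<open>The mean of the dominating quadratic depends on the law of \<open>\<xi>\<close> only
  through mean and variance, so it can be computed for variance \<open>w\<close> and corrected
  linearly by \<open>v - w\<close>, where \<open>v\<close> may lie on either side of
  \<open>w\<close>. Writing the correction as an exponential lets the corrections of several factors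
  add up.\<close>

lemma (in prob_space) mgf_le_two_point:
  assumes [measurable]: "\<xi> \<in> borel_measurable M"
    and le1: "AE \<omega> in M. \<xi> \<omega> \<le> 1" and int: "integrable M \<xi>" and int2: "integrable M (\<lambda>\<omega>. (\<xi> \<omega>)\<^sup>2)"
    and mean: "expectation \<xi> = 0" and var: "expectation (\<lambda>\<omega>. (\<xi> \<omega>)\<^sup>2) \<le> v"
    and "t > 0" "w > 0"
  shows "(\<integral>\<^sup>+ \<omega>. ennreal (exp (t * \<xi> \<omega>)) \<partial>M)
    \<le> ennreal (two_point_mgf t w * exp (mgf_slope t w / two_point_mgf t w * (v - w)))"
proof -
  let ?c = "t * (1 + w)" and ?A = "two_point_mgf t w"
  \<comment> \<open>For \<open>z \<le> 1\<close> the shifted exponent \<open>t * (z + w)\<close> is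
    at most \<open>?c\<close>, so \<open>exp_le_quadratic\<close> is used with
    \<open>c = ?c\<close>. The shift by \<open>w\<close> makes \<open>q\<close> below tangent to the
    exponential at \<open>-w\<close>.\<close>
  define \<phi> where "\<phi> = (exp ?c - 1 - ?c) / ?c\<^sup>2"
  have c: "?c > 0" using assms by simp
  have \<phi>: "\<phi> \<ge> 0" unfolding \<phi>_def using exp_ge_add_one_self[of ?c] by (intro divide_nonneg_nonneg zero_le_power2) linarith
  define q where "q = (\<lambda>z. exp (- t * w) * (1 + t * (z + w) + (t * (z + w))\<^sup>2 * \<phi>))"
  have q_eq: "q z = exp (- t * w) * (1 + t * w + t\<^sup>2 * w\<^sup>2 * \<phi>) 
      + exp (- t * w) * (t + 2 * t\<^sup>2 * w * \<phi>) * z + exp (- t * w) * t\<^sup>2 * \<phi> * z\<^sup>2" for z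
    by (simp add: q_def power2_eq_square algebra_simps)
  have le: "exp (t * z) \<le> q z" if "z \<le> 1" for z
  proof -
    have "exp (t * (z + w)) \<le> 1 + t * (z + w) + (t * (z + w))\<^sup>2 * \<phi>"
      unfolding \<phi>_def using that assms by (intro exp_le_quadratic c) simp
    then have "exp (- t * w) * exp (t * (z + w)) \<le> q z"
      unfolding q_def by (intro mult_left_mono) auto
    then show ?thesis by (simp add: exp_add[symmetric] algebra_simps)
  qed
  have intq: "integrable M (\<lambda>\<omega>. q (\<xi> \<omega>))"
    unfolding q_eq using int int2 by (intro Bochner_Integration.integrable_add) auto
  have inte: "integrable M (\<lambda>\<omega>. exp (t * \<xi> \<omega>))"
  proof (rule Bochner_Integration.integrable_bound[OF intq])
    show "AE \<omega> in M. norm (exp (t * \<xi> \<omega>)) \<le> norm (q (\<xi> \<omega>))"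
      using le1 by eventually_elim (use le in force)
  qed auto
  have slope: "mgf_slope t w = exp (- t * w) * t\<^sup>2 * \<phi>"
    using assms unfolding mgf_slope_def \<phi>_def power_mult_distrib by simp
  \<comment> \<open>The right-hand side is the mean of \<open>q\<close> under any centred law with
    variance \<open>w\<close>. On the two points \<open>-w\<close> and 1, \<open>q\<close> coincides
    with the exponential, hence the equality.\<close>
  have A: "?A = exp (- t * w) * (1 + t * w + t\<^sup>2 * (w + w\<^sup>2) * \<phi>)"
  proof -
    have "t\<^sup>2 * (w + w\<^sup>2) * \<phi> = w * (exp ?c - 1 - ?c) / (1 + w)"
      using assms unfolding \<phi>_def power2_eq_square by (simp add: divide_simps) (simp add: algebra_simps)
    moreover have "1 + t * w + w * (exp ?c - 1 - ?c) / (1 + w) = (1 + w * exp ?c) / (1 + w)"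
      using assms by (simp add: field_simps)
    ultimately have "exp (- t * w) * (1 + t * w + t\<^sup>2 * (w + w\<^sup>2) * \<phi>) 
        = exp (- t * w) * ((1 + w * exp ?c) / (1 + w))" by simp
    also have "\<dots> = (exp (- t * w) + w * (exp (- t * w) * exp ?c)) / (1 + w)"
      by (simp add: algebra_simps)
    also have "exp (- t * w) * exp ?c = exp t"
      by (simp add: exp_add[symmetric] algebra_simps)
    finally show ?thesis by (simp add: two_point_mgf_def)
  qed
  have Apos: "?A > 0" using assms by (intro two_point_mgf_pos) simp
  have "expectation (\<lambda>\<omega>. exp (t * \<xi> \<omega>)) \<le> expectation (\<lambda>\<omega>. q (\<xi> \<omega>))"
    by (intro integral_mono_AE inte intq) (use le1 le in auto)
  also have "\<dots> = exp (- t * w) * (1 + t * w + t\<^sup>2 * w\<^sup>2 * \<phi>) 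
      + exp (- t * w) * t\<^sup>2 * \<phi> * expectation (\<lambda>\<omega>. (\<xi> \<omega>)\<^sup>2)"
    unfolding q_eq using int int2 mean by (simp add: prob_space)
  also have "\<dots> \<le> exp (- t * w) * (1 + t * w + t\<^sup>2 * w\<^sup>2 * \<phi>) + exp (- t * w) * t\<^sup>2 * \<phi> * v"
    using var \<phi> by (intro add_left_mono mult_left_mono) auto
  also have "\<dots> = ?A + mgf_slope t w * (v - w)"
    unfolding A slope by (simp add: algebra_simps)
  also have "\<dots> = ?A * (1 + mgf_slope t w / ?A * (v - w))"
    using Apos by (simp add: field_simps)
  also have "\<dots> \<le> ?A * exp (mgf_slope t w / ?A * (v - w))"
    using Apos by (intro mult_left_mono exp_ge_add_one_self) auto
  finally show ?thesis
    using inte by (subst nn_integral_eq_integral) (auto intro!: ennreal_leI)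
qed

section \<open>Optimising Chernoff's bound\<close>

text \<open>\<open>H_bound\<close> is the infimum of the given bounds over \<open>t\<close>. For
  \<open>x < n\<close> it is attained at a stationary point; for \<open>x \<ge> n\<close> it is
  approached as \<open>t\<close> tends to infinity, which accounts for the convention at
  \<open>x = n\<close> and for the indicator.\<close>

lemma chernoff_le_H_bound:
  fixes p x v :: real and n :: nat
  assumes "n \<ge> 1" "x > 0" "v > 0"
    and p: "\<And>t. t > 0 \<Longrightarrow> p \<le> exp (- t * x) * two_point_mgf t (v\<^sup>2 / n) ^ n"
  shows "p \<le> H_bound n x v"
proof -
  define w where "w = v\<^sup>2 / n"
  have w: "w > 0" using assms by (simp add: w_def)
  have v2: "v\<^sup>2 = n * w" using assms by (simp add: w_def)
  note p = p[folded w_def]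
  consider "x < n" | "x \<ge> n" by linarith
  then show ?thesis
  proof cases
    case 1
    \<comment> \<open>Setting the derivative of \<open>- t * x + n * ln (two_point_mgf t w)\<close>
      to zero and solving for \<open>exp (t * (1 + w))\<close> gives \<open>r\<close>.\<close>
    define r where "r = (x + v\<^sup>2) * n / (v\<^sup>2 * (n - x))"
    define t where "t = ln r / (1 + w)"
    have v2pos: "v\<^sup>2 > 0" using assms by simp
    then have xv: "x + v\<^sup>2 > 0" using assms by (intro add_pos_pos)
    have r1: "r > 1"
    proof -
      have "v\<^sup>2 * (n - x) < (x + v\<^sup>2) * n"
        using mult_pos_pos[of x "real n"] mult_pos_pos[of "v\<^sup>2" x] assms v2pos
        by (simp add: algebra_simps del: mult_pos_pos zero_less_mult_iff)
      then show ?thesis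
        unfolding r_def using 1 v2pos by (simp add: less_divide_eq)
    qed
    then have t: "t > 0" using w by (simp add: t_def)
    have lr: "ln r = t * (1 + w)" using w by (simp add: t_def)
    then have er: "exp (t * (1 + w)) = r" using r1 by (simp add: lr[symmetric])
    have A: "two_point_mgf t w = exp (- t * w) * (n / (n - x))"
    proof -
      have "exp t = exp (- t * w) * r" unfolding er[symmetric] by (simp add: exp_add[symmetric] algebra_simps)
      then have "two_point_mgf t w = exp (- t * w) * ((1 + w * r) / (1 + w))"
        by (simp add: two_point_mgf_def field_simps)
      also have "w * r = (x + v\<^sup>2) / (n - x)"
        unfolding r_def v2 using w 1 assms by (simp add: divide_simps)
      also have "(1 + (x + v\<^sup>2) / (n - x)) / (1 + w) = n / (n - x)"
        unfolding v2 using w 1 assms by (simp add: divide_simps) (simp add: algebra_simps)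
      finally show ?thesis .
    qed
    have "exp (- t * x) * two_point_mgf t w ^ n = exp (- t * x) * exp (- t * w) ^ n * exp (n * ln (n / (n - x)))"
      unfolding A power_mult_distrib using 1 assms by (simp add: exp_of_nat_mult)
    also have "\<dots> = exp (- t * x - t * w * n + n * ln (n / (n - x)))"
      by (simp add: exp_of_nat_mult[symmetric] exp_add[symmetric] algebra_simps)
    also have "- t * x - t * w * n + n * ln (n / (n - x)) =
       n / (n + v\<^sup>2) * ((x + v\<^sup>2) * ln (v\<^sup>2 / (x + v\<^sup>2)) + (n - x) * ln (n / (n - x)))"
    proof -
      have 1: "ln r = - ln (v\<^sup>2 / (x + v\<^sup>2)) + ln (n / (n - x))"
        unfolding r_def using 1 assms v2pos xv by (simp add: ln_div ln_mult)
      have 2: "t * x + t * w * n = ln r * (x + v\<^sup>2) * (n / (n + v\<^sup>2))"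
      proof -
        have "n / (n + v\<^sup>2) = 1 / (1 + w)"
          unfolding v2 using w assms by (simp add: frac_eq_eq add_pos_pos algebra_simps add_nonneg_eq_0_iff)
        then show ?thesis by (simp add: t_def v2 algebra_simps add_divide_distrib)
      qed
      have 3: "real n = (n - x) * (n / (n + v\<^sup>2)) + (x + v\<^sup>2) * (n / (n + v\<^sup>2))"
      proof -
        have "real n + v\<^sup>2 \<noteq> 0" using v2pos by (intro less_imp_neq[symmetric] add_nonneg_pos) auto
        then show ?thesis unfolding distrib_right[symmetric] by simp
      qed
      \<comment> \<open>With logarithms and quotients abstracted to variables, a polynomial identity
        remains; \<open>L\<close> stands for \<open>ln r\<close> and \<open>q\<close> for
        \<open>n / (n + v\<^sup>2)\<close>.\<close>
      have 4: "- (L * b * q) + N * l = q * (b * a + c * l)" if "L = - a + l" "N = c * q + b * q"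
        for L a b c l q N :: real
        unfolding that by (simp add: algebra_simps)
      have "- t * x - t * w * n + n * ln (n / (n - x)) = - (t * x + t * w * n) + n * ln (n / (n - x))"
        by simp
      also have "\<dots> = n / (n + v\<^sup>2) * ((x + v\<^sup>2) * ln (v\<^sup>2 / (x + v\<^sup>2)) + (n - x) * ln (n / (n - x)))"
        unfolding 2 by (rule 4[OF 1 3])
      finally show ?thesis .
    qed
    also have "exp \<dots> = H_bound n x v"
      unfolding H_bound_def using 1 assms v2pos xv
      by (simp add: powr_def ln_mult exp_add)
    finally show ?thesis using p[OF t] by simp
  next
    case 2
    \<comment> \<open>One \<open>exp t\<close> is taken out of each of the \<open>n\<close> factors.
      The remaining base converges to \<open>w / (1 + w)\<close>, and for \<open>x > n\<close> the
      prefactor tends to 0.\<close>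
    have b: "p \<le> exp (- t * (x - n)) * ((exp (- t * (1 + w)) + w) / (1 + w)) ^ n" if "t > 0" for t
    proof -
      have "two_point_mgf t w = exp t * ((exp (- t * (1 + w)) + w) / (1 + w))"
        unfolding two_point_mgf_def by (simp add: algebra_simps exp_add[symmetric])
      then have "exp (- t * x) * two_point_mgf t w ^ n = 
          exp (- t * x) * exp t ^ n * ((exp (- t * (1 + w)) + w) / (1 + w)) ^ n"
        by (simp only: power_mult_distrib mult.assoc)
      also have "exp (- t * x) * exp t ^ n = exp (- t * (x - n))"
        by (simp add: exp_of_nat_mult[symmetric] exp_add[symmetric] algebra_simps)
      finally show ?thesis using p[OF that] by simp
    qed
    have lim1: "((\<lambda>t. exp (- t * c)) \<longlongrightarrow> 0) at_top" if "c > 0" for c :: real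
      using that by real_asymp
    have lim2: "((\<lambda>t. ((exp (- t * (1 + w)) + w) / (1 + w)) ^ n) \<longlongrightarrow> ((0 + w) / (1 + w)) ^ n) at_top"
      using w by (intro tendsto_intros lim1) auto
    show ?thesis
    proof (cases "x = n")
      case True
      have "p \<le> ((0 + w) / (1 + w)) ^ n"
        by (rule tendsto_lowerbound[OF lim2]) (use b True in \<open>auto intro!: eventually_at_top_linorderI[of 1]\<close>)
      also have "(0 + w) / (1 + w) = v\<^sup>2 / (n + v\<^sup>2)"
        unfolding v2 using w assms by (simp add: frac_eq_eq add_pos_pos algebra_simps add_nonneg_eq_0_iff)
      \<comment> \<open>At \<open>x = n\<close> the second factor of \<open>H_bound\<close> is 1,
        and the exponents \<open>n + v\<^sup>2\<close> and \<open>n / (n + v\<^sup>2)\<close>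
        multiply to \<open>n\<close>.\<close>
      also have "\<dots> ^ n = H_bound n x v"
        unfolding H_bound_def using True assms by (simp add: powr_powr powr_realpow add_pos_pos)
      finally show ?thesis .
    next
      case False
      have "((\<lambda>t. exp (- t * (x - n)) * ((exp (- t * (1 + w)) + w) / (1 + w)) ^ n) \<longlongrightarrow> 
          0 * ((0 + w) / (1 + w)) ^ n) at_top"
        using False 2 by (intro tendsto_mult[OF _ lim2] lim1) auto
      then have "p \<le> 0 * ((0 + w) / (1 + w)) ^ n"
        by (rule tendsto_lowerbound) (use b in \<open>auto intro!: eventually_at_top_linorderI[of 1]\<close>)
      then show ?thesis using False 2 by (simp add: H_bound_def)
    qed
  qed
qed

section \<open>The renewal recursion of the coefficients\<close>

declare diag_coeff.simps(2) [simp del]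

text \<open>Starting the sum at \<open>l = 0\<close> absorbs the separate summand
  \<open>a k\<close>, because \<open>diag_coeff a 0 = 1\<close>, and lets one formula cover
  \<open>k = 0\<close> as well.\<close>

lemma diag_coeff_eq: "diag_coeff a k = 1 + (\<Sum>l<k. diag_coeff a l * a (k - l))"
proof (cases k)
  case (Suc m)
  have "(\<Sum>l=1..m. diag_coeff a l * a (Suc m - l)) = (\<Sum>l<m. diag_coeff a (Suc l) * a (m - l))"
    by (simp add: sum.atLeast1_atMost_eq)
  then show ?thesis
    unfolding Suc sum.lessThan_Suc_shift by (simp add: diag_coeff.simps(2)[of a m])
qed simp

text \<open>The lower bound keeps the terms of the sum nonnegative. For the growth, the sum for
  \<open>Suc k\<close> is shifted by one index, so that equal weights \<open>a (k - l)\<close> face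
  each other.\<close>

lemma diag_coeff_mono_Suc:
  assumes "\<And>i. i \<ge> 1 \<Longrightarrow> a i \<ge> 0"
  shows "1 \<le> diag_coeff a k \<and> diag_coeff a k \<le> diag_coeff a (Suc k)"
proof (induction k rule: less_induct)
  case (less k)
  have pos: "diag_coeff a l \<ge> 0" if "l < k" for l
    using less[OF that] by simp
  have 1: "1 \<le> diag_coeff a k"
    by (subst diag_coeff_eq) (auto intro!: sum_nonneg mult_nonneg_nonneg pos assms)
  have "(\<Sum>l<k. diag_coeff a l * a (k - l)) \<le> (\<Sum>l<k. diag_coeff a (Suc l) * a (k - l))"
    using less by (intro sum_mono mult_right_mono assms) auto
  \<comment> \<open>The extra term has \<open>l = 0\<close> and equals
    \<open>a (Suc k)\<close>.\<close>
  also have "\<dots> \<le> (\<Sum>l<Suc k. diag_coeff a l * a (Suc k - l))"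
    using assms[of "Suc k"] by (simp add: sum.lessThan_Suc_shift del: sum.lessThan_Suc)
  finally have "diag_coeff a k \<le> diag_coeff a (Suc k)"
    unfolding diag_coeff_eq[of a k] diag_coeff_eq[of a "Suc k"] by (intro add_left_mono)
  with 1 show ?case ..
qed

lemma diag_coeff_mono:
  assumes "\<And>i. i \<ge> 1 \<Longrightarrow> a i \<ge> 0" "j \<le> k"
  shows "diag_coeff a j \<le> diag_coeff a k"
  by (rule lift_Suc_mono_le[of "diag_coeff a"]) (use diag_coeff_mono_Suc assms in auto)

lemma diag_coeff_ge_1:
  assumes "\<And>i. i \<ge> 1 \<Longrightarrow> a i \<ge> 0"
  shows "diag_coeff a k \<ge> 1"
  using diag_coeff_mono_Suc[of a] assms by blast

section \<open>Lipschitz functions of a single noise variable\<close>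

lemma mean_dist_measurable [measurable]:
  assumes "prob_space Q" and [measurable_cong]: "sets Q = sets borel"
  shows "mean_dist Q \<in> borel_measurable borel"
proof -
  interpret prob_space Q by fact
  show ?thesis unfolding mean_dist_def by measurable
qed

lemma lipschitz_borel_measurable:
  fixes g :: "'y::polish_space \<Rightarrow> real"
  assumes "\<And>y y'. \<bar>g y - g y'\<bar> \<le> L * dist y y'" "L \<ge> 0"
  shows "g \<in> borel_measurable borel"
proof (rule borel_measurable_continuous_onI)
  have "L-lipschitz_on UNIV g"
    using assms by (intro lipschitz_onI) (auto simp: dist_real_def)
  then show "continuous_on UNIV g" by (rule lipschitz_on_continuous_on)
qed

text \<open>Since \<open>g\<close> differs from \<open>g y\<close> by at most
  \<open>L * dist y y'\<close>, one point \<open>y\<close> of finite mean distance makes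
  \<open>g\<close> integrable, and integrating the same inequality bounds the deviation at
  \<open>y\<close>.\<close>

lemma lipschitz_integrable:
  fixes g :: "'y::polish_space \<Rightarrow> real"
  assumes Q: "prob_space Q" and sets [measurable_cong]: "sets Q = sets borel"
    and g: "\<And>y y'. \<bar>g y - g y'\<bar> \<le> L * dist y y'" "L \<ge> 0"
    and y: "mean_dist Q y < \<infinity>"
  shows "integrable Q g" "ennreal \<bar>g y - (\<integral>y'. g y' \<partial>Q)\<bar> \<le> ennreal L * mean_dist Q y"
proof -
  interpret prob_space Q by fact
  have gm [measurable]: "g \<in> borel_measurable borel" using lipschitz_borel_measurable[OF g] .
  have "(\<integral>\<^sup>+ y'. ennreal (norm (g y - g y')) \<partial>Q) \<le> (\<integral>\<^sup>+ y'. ennreal L * ennreal (dist y y') \<partial>Q)"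
    using g by (intro nn_integral_mono) (auto simp: ennreal_mult[symmetric] intro!: ennreal_leI)
  also have "\<dots> = ennreal L * mean_dist Q y"
    unfolding mean_dist_def by (intro nn_integral_cmult) measurable
  finally have le: "(\<integral>\<^sup>+ y'. ennreal (norm (g y - g y')) \<partial>Q) \<le> ennreal L * mean_dist Q y" .
  also have "\<dots> < \<infinity>" using y by (simp add: ennreal_mult_less_top)
  finally have int: "integrable Q (\<lambda>y'. g y - g y')"
    by (intro integrableI_bounded) auto
  have "integrable Q (\<lambda>y'. g y - (g y - g y'))"
    by (intro Bochner_Integration.integrable_diff int) simp
  then show g_int: "integrable Q g" by simp
  have "ennreal (norm (\<integral>y'. g y - g y' \<partial>Q)) \<le> (\<integral>\<^sup>+ y'. ennreal (norm (g y - g y')) \<partial>Q)"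
    by (rule integral_norm_bound_ennreal[OF int])
  also have "(\<integral>y'. g y - g y' \<partial>Q) = g y - (\<integral>y'. g y' \<partial>Q)"
    using g_int by (simp add: prob_space)
  finally show "ennreal \<bar>g y - (\<integral>y'. g y' \<partial>Q)\<bar> \<le> ennreal L * mean_dist Q y"
    using le by simp
qed

lemma lipschitz_deviation:
  fixes g :: "'y::polish_space \<Rightarrow> real"
  assumes Q: "prob_space Q" and sets [measurable_cong]: "sets Q = sets borel"
    and g: "\<And>y y'. \<bar>g y - g y'\<bar> \<le> L * dist y y'" "L \<ge> 0"
    and M: "M \<ge> 0" "AE y in Q. mean_dist Q y \<le> ennreal M"
  shows "integrable Q g"
    and "AE y in Q. ennreal \<bar>g y - (\<integral>y'. g y' \<partial>Q)\<bar> \<le> ennreal L * mean_dist Q y"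
    and "AE y in Q. \<bar>g y - (\<integral>y'. g y' \<partial>Q)\<bar> \<le> L * M"
proof -
  interpret prob_space Q by fact
  have fin: "mean_dist Q y < \<infinity>" if "mean_dist Q y \<le> ennreal M" for y
    using that le_less_trans[OF that ennreal_less_top] by simp
  \<comment> \<open>The bound holds almost everywhere for a probability measure, hence somewhere;
    that point serves as base point for integrability.\<close>
  have "\<exists>y. mean_dist Q y \<le> ennreal M"
  proof (rule ccontr)
    assume neg: "\<nexists>y. mean_dist Q y \<le> ennreal M"
    have "AE y in Q. False" using M(2) by eventually_elim (use neg in auto)
    then show False by simp
  qed
  then show "integrable Q g"
    using lipschitz_integrable(1)[OF Q sets g] fin by blast
  show dev: "AE y in Q. ennreal \<bar>g y - (\<integral>y'. g y' \<partial>Q)\<bar> \<le> ennreal L * mean_dist Q y"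
    using M(2) by eventually_elim (intro lipschitz_integrable(2)[OF Q sets g] fin)
  show "AE y in Q. \<bar>g y - (\<integral>y'. g y' \<partial>Q)\<bar> \<le> L * M"
    using dev M(2)
  proof eventually_elim
    case (elim y)
    have "ennreal \<bar>g y - (\<integral>y'. g y' \<partial>Q)\<bar> \<le> ennreal L * ennreal M"
      using elim by (meson mult_left_mono order_trans zero_le)
    also have "\<dots> = ennreal (L * M)" using g M by (simp add: ennreal_mult)
    finally show ?case using g M by (simp add: ennreal_le_iff)
  qed
qed

text \<open>Division by \<open>C\<close> brings the deviation of \<open>g\<close> below 1, and the
  pointwise bound \<open>L * mean_dist Q y\<close> controls its variance, so
  \<open>mgf_le_two_point\<close> applies. \<open>C\<close> is kept apart from \<open>L * M\<close>
  so that all steps of the chain can share it.\<close>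

lemma lipschitz_mgf_le:
  fixes g :: "'y::polish_space \<Rightarrow> real"
  assumes Q: "prob_space Q" and sets [measurable_cong]: "sets Q = sets borel"
    and g: "\<And>y y'. \<bar>g y - g y'\<bar> \<le> L * dist y y'" "L \<ge> 0"
    and M: "M \<ge> 0" "AE y in Q. mean_dist Q y \<le> ennreal M"
    and V: "V \<ge> 0" "(\<integral>\<^sup>+ y. (mean_dist Q y)\<^sup>2 \<partial>Q) \<le> ennreal V"
    and C: "C > 0" "L * M \<le> C" and tw: "t > 0" "w > 0"
  shows "(\<integral>\<^sup>+ y. ennreal (exp (t * ((g y - (\<integral>y'. g y' \<partial>Q)) / C))) \<partial>Q)
    \<le> ennreal (two_point_mgf t w * exp (mgf_slope t w / two_point_mgf t w * (L\<^sup>2 * V / C\<^sup>2 - w)))"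
proof -
  interpret prob_space Q by fact
  note dev = lipschitz_deviation[OF Q sets g M]
  have gm [measurable]: "g \<in> borel_measurable borel" using lipschitz_borel_measurable[OF g] .
  note [measurable] = mean_dist_measurable[OF Q sets]
  define \<xi> where "\<xi> = (\<lambda>y. (g y - (\<integral>y'. g y' \<partial>Q)) / C)"
  have [measurable]: "\<xi> \<in> borel_measurable borel" unfolding \<xi>_def by measurable
  have \<xi>_le: "AE y in Q. \<bar>\<xi> y\<bar> \<le> 1"
    using dev(3) by eventually_elim (use C in \<open>simp add: \<xi>_def abs_divide\<close>)
  have int: "integrable Q \<xi>" unfolding \<xi>_def using dev(1) by simp
  have int2: "integrable Q (\<lambda>y. (\<xi> y)\<^sup>2)"
  proof (rule integrable_const_bound[where B = 1])
    show "AE y in Q. norm ((\<xi> y)\<^sup>2) \<le> 1"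
      using \<xi>_le by eventually_elim (simp add: abs_square_le_1)
  qed measurable
  have "ennreal (expectation (\<lambda>y. (\<xi> y)\<^sup>2)) = (\<integral>\<^sup>+ y. ennreal ((\<xi> y)\<^sup>2) \<partial>Q)"
    by (intro nn_integral_eq_integral[symmetric] int2) auto
  also have "\<dots> \<le> (\<integral>\<^sup>+ y. ennreal (L\<^sup>2 / C\<^sup>2) * (mean_dist Q y)\<^sup>2 \<partial>Q)"
  proof (rule nn_integral_mono_AE)
    show "AE y in Q. ennreal ((\<xi> y)\<^sup>2) \<le> ennreal (L\<^sup>2 / C\<^sup>2) * (mean_dist Q y)\<^sup>2"
      using dev(2)
    proof eventually_elim
      case (elim y)
      have "ennreal ((\<xi> y)\<^sup>2) = ennreal (1 / C\<^sup>2) * (ennreal \<bar>g y - (\<integral>y'. g y' \<partial>Q)\<bar>)\<^sup>2"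
        by (simp add: \<xi>_def power_divide ennreal_power ennreal_mult[symmetric])
      also have "\<dots> \<le> ennreal (1 / C\<^sup>2) * (ennreal L * mean_dist Q y)\<^sup>2"
        using elim by (intro mult_left_mono power_mono) auto
      also have "\<dots> = ennreal (L\<^sup>2 / C\<^sup>2) * (mean_dist Q y)\<^sup>2"
      proof -
        have "ennreal (1 / C\<^sup>2) * ennreal (L\<^sup>2) = ennreal (L\<^sup>2 / C\<^sup>2)"
          by (subst ennreal_mult[symmetric]) auto
        then show ?thesis
          using g by (simp add: power_mult_distrib ennreal_power flip: mult.assoc)
      qed
      finally show ?case .
    qed
  qed
  also have "\<dots> = ennreal (L\<^sup>2 / C\<^sup>2) * (\<integral>\<^sup>+ y. (mean_dist Q y)\<^sup>2 \<partial>Q)"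
    by (intro nn_integral_cmult) measurable
  also have "\<dots> \<le> ennreal (L\<^sup>2 / C\<^sup>2) * ennreal V"
    using V by (intro mult_left_mono) auto
  also have "\<dots> = ennreal (L\<^sup>2 * V / C\<^sup>2)"
    using V by (simp add: ennreal_mult[symmetric])
  finally have var: "expectation (\<lambda>y. (\<xi> y)\<^sup>2) \<le> L\<^sup>2 * V / C\<^sup>2"
    using V by (simp add: ennreal_le_iff)
  have "(\<integral>\<^sup>+ y. ennreal (exp (t * \<xi> y)) \<partial>Q)
    \<le> ennreal (two_point_mgf t w * exp (mgf_slope t w / two_point_mgf t w * (L\<^sup>2 * V / C\<^sup>2 - w)))"
  proof (rule mgf_le_two_point[OF _ _ int int2 _ var tw])
    show "AE y in Q. \<xi> y \<le> 1" using \<xi>_le by eventually_elim simp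
    show "expectation \<xi> = 0" unfolding \<xi>_def using dev(1) by (simp add: prob_space)
  qed measurable
  then show ?thesis by (simp add: \<xi>_def)
qed

section \<open>The chain on the product space of its noise\<close>

text \<open>Only the laws \<open>Q i\<close> of the noise enter, so the argument runs on a product
  space, where conditioning on the first noise variables means integrating out the later
  ones.\<close>

locale contractive_chain =
  fixes Q :: "nat \<Rightarrow> 'y::polish_space measure"
    and F :: "nat \<Rightarrow> (nat \<Rightarrow> 'x::polish_space) \<Rightarrow> 'y \<Rightarrow> 'x"
    and X0 :: "int \<Rightarrow> 'x" and a :: "nat \<Rightarrow> real"
    and n :: nat and f :: "(nat \<Rightarrow> 'x) \<Rightarrow> real" and M :: real and V :: "nat \<Rightarrow> real"
  assumes prob_space_Q: "prob_space (Q i)"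
    and sets_Q [measurable_cong]: "sets (Q i) = sets borel"
    and F_measurable: "m \<ge> 1 \<Longrightarrow>
      (\<lambda>(z, y). F m z y) \<in> measurable ((\<Pi>\<^sub>M i\<in>{1..}. borel) \<Otimes>\<^sub>M borel) borel"
    and a_nonneg: "i \<ge> 1 \<Longrightarrow> a i \<ge> 0"
    and F_contraction: "m \<ge> 1 \<Longrightarrow> z \<in> {1..} \<rightarrow>\<^sub>E UNIV \<Longrightarrow> z' \<in> {1..} \<rightarrow>\<^sub>E UNIV \<Longrightarrow>
      (\<integral>\<^sup>+ y. ennreal (dist (F m z y) (F m z' y)) \<partial>Q m)
        \<le> (\<Sum>i. ennreal (a (Suc i) * dist (z (Suc i)) (z' (Suc i))))"
    and F_lipschitz: "m \<ge> 1 \<Longrightarrow> z \<in> {1..} \<rightarrow>\<^sub>E UNIV \<Longrightarrow> dist (F m z y) (F m z y') \<le> dist y y'"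
    and f_lipschitz: "u \<in> {1..n} \<rightarrow>\<^sub>E UNIV \<Longrightarrow> u' \<in> {1..n} \<rightarrow>\<^sub>E UNIV \<Longrightarrow>
      \<bar>f u - f u'\<bar> \<le> (\<Sum>i=1..n. dist (u i) (u' i))"
    and M_pos: "M > 0" and V_pos: "k \<in> {1..n} \<Longrightarrow> V k > 0"
    and mean_dist_le: "k \<in> {1..n} \<Longrightarrow> AE y in Q k. mean_dist (Q k) y \<le> ennreal M"
    and mean_dist_sq_le: "k \<in> {1..n} \<Longrightarrow> (\<integral>\<^sup>+ y. (mean_dist (Q k) y)\<^sup>2 \<partial>Q k) \<le> ennreal (V k)"
    and n_pos: "n \<ge> 1"
begin

abbreviation "K \<equiv> diag_coeff a"

abbreviation states :: "(nat \<Rightarrow> 'x) measure" where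
  "states \<equiv> \<Pi>\<^sub>M i\<in>UNIV. borel"

text \<open>States are indexed by absolute time, whereas \<open>F m\<close> takes lags counted
  backwards from \<open>m\<close>.\<close>

definition hist :: "nat \<Rightarrow> (nat \<Rightarrow> 'x) \<Rightarrow> nat \<Rightarrow> 'x" where
  "hist m u = (\<lambda>i\<in>{1..}. if i < m then u (m - i) else X0 (int m - int i))"

definition step :: "nat \<Rightarrow> (nat \<Rightarrow> 'x) \<Rightarrow> 'y \<Rightarrow> nat \<Rightarrow> 'x" where
  "step m u y = u(m := F m (hist m u) y)"

text \<open>Total functions keep the state space the same for every \<open>k\<close>;
  \<open>X0 0\<close> fills the coordinates outside \<open>{1..k}\<close>.\<close>

primrec path :: "nat \<Rightarrow> (nat \<Rightarrow> 'y) \<Rightarrow> nat \<Rightarrow> 'x" where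
  "path 0 e = (\<lambda>_. X0 0)"
| "path (Suc k) e = step (Suc k) (path k e) (e (Suc k))"

text \<open>
  \<open>value_fun j\<close> is the conditional expectation of \<open>f (X_1, ..., X_n)\<close> given the first
  \<open>n - j\<close> coordinates; coordinates beyond \<open>n - j\<close> of the argument are irrelevant.
\<close>

primrec value_fun :: "nat \<Rightarrow> (nat \<Rightarrow> 'x) \<Rightarrow> real" where
  "value_fun 0 u = f (restrict u {1..n})"
| "value_fun (Suc j) u = (\<integral>y. value_fun j (step (n - j) u y) \<partial>Q (n - j))"

text \<open>A Lipschitz constant of \<open>value_fun j\<close> in coordinate \<open>i\<close>.
  Integrating out the noise at time \<open>n - l\<close> passes the weight \<open>K l\<close> of
  that coordinate on to coordinate \<open>i\<close>, which lies \<open>n - l - i\<close> steps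
  earlier.\<close>

definition lip_coeff :: "nat \<Rightarrow> nat \<Rightarrow> real" where
  "lip_coeff j i = 1 + (\<Sum>l<j. K l * a (n - l - i))"

lemma K_ge_1: "K j \<ge> 1"
  using a_nonneg by (rule diag_coeff_ge_1)

text \<open>At the last remaining coordinate the lag \<open>n - l - i\<close> becomes
  \<open>j - l\<close>, and the sum is the one in \<open>diag_coeff_eq\<close>.\<close>

lemma lip_coeff_diag: "j \<le> n \<Longrightarrow> lip_coeff j (n - j) = K j"
  unfolding lip_coeff_def diag_coeff_eq[of a j] by (auto intro!: sum.cong)

lemma lip_coeff_Suc: "lip_coeff (Suc j) i = lip_coeff j i + K j * a (n - j - i)"
  by (simp add: lip_coeff_def)

lemma hist_in: "hist m u \<in> {1..} \<rightarrow>\<^sub>E UNIV"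
  by (simp add: hist_def)

lemma F_hist_measurable:
  assumes "m \<ge> 1"
  shows "F m (hist m u) \<in> borel_measurable borel"
proof (rule borel_measurable_continuous_onI)
  have "1-lipschitz_on UNIV (F m (hist m u))"
    using F_lipschitz[OF assms hist_in] by (intro lipschitz_onI) auto
  then show "continuous_on UNIV (F m (hist m u))" by (rule lipschitz_on_continuous_on)
qed

text \<open>Both histories share the deterministic past, so only lags below \<open>m\<close>
  contribute. The series becomes a finite sum, which also yields integrability.\<close>

lemma F_hist_contraction:
  assumes "m \<ge> 1"
  shows "integrable (Q m) (\<lambda>y. dist (F m (hist m u) y) (F m (hist m u') y))"
    and "(\<integral>y. dist (F m (hist m u) y) (F m (hist m u') y) \<partial>Q m)
      \<le> (\<Sum>i=1..<m. a (m - i) * dist (u i) (u' i))"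
proof -
  note [measurable] = F_hist_measurable[OF assms]
  have nonneg: "0 \<le> (\<Sum>i=1..<m. a (m - i) * dist (u i) (u' i))"
    by (intro sum_nonneg mult_nonneg_nonneg a_nonneg) auto
  have "(\<integral>\<^sup>+ y. ennreal (dist (F m (hist m u) y) (F m (hist m u') y)) \<partial>Q m)
      \<le> (\<Sum>i. ennreal (a (Suc i) * dist (hist m u (Suc i)) (hist m u' (Suc i))))"
    by (rule F_contraction[OF assms hist_in hist_in])
  also have "\<dots> = (\<Sum>i\<in>{..<m - 1}. ennreal (a (Suc i) * dist (hist m u (Suc i)) (hist m u' (Suc i))))"
    by (rule suminf_finite) (auto simp: hist_def)
  also have "\<dots> = ennreal (\<Sum>i\<in>{..<m - 1}. a (Suc i) * dist (hist m u (Suc i)) (hist m u' (Suc i)))"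
    by (intro sum_ennreal mult_nonneg_nonneg a_nonneg) auto
  also have "(\<Sum>i\<in>{..<m - 1}. a (Suc i) * dist (hist m u (Suc i)) (hist m u' (Suc i)))
      = (\<Sum>i=1..<m. a (m - i) * dist (u i) (u' i))"
    \<comment> \<open>\<open>m - Suc i\<close> is the absolute time at lag \<open>Suc i\<close>, and
      the same formula inverts it.\<close>
    by (rule sum.reindex_bij_witness[of _ "\<lambda>i. m - Suc i" "\<lambda>i. m - Suc i"]) (auto simp: hist_def)
  finally have le: "(\<integral>\<^sup>+ y. ennreal (dist (F m (hist m u) y) (F m (hist m u') y)) \<partial>Q m)
      \<le> ennreal (\<Sum>i=1..<m. a (m - i) * dist (u i) (u' i))" .
  show int: "integrable (Q m) (\<lambda>y. dist (F m (hist m u) y) (F m (hist m u') y))"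
    using le_less_trans[OF le ennreal_less_top] by (intro integrableI_bounded) auto
  show "(\<integral>y. dist (F m (hist m u) y) (F m (hist m u') y) \<partial>Q m)
      \<le> (\<Sum>i=1..<m. a (m - i) * dist (u i) (u' i))"
    using le nonneg by (simp add: nn_integral_eq_integral[OF int] ennreal_le_iff)
qed

text \<open>\<open>step\<close> overwrites only coordinate \<open>n - j\<close>, whose coefficient
  is \<open>K j\<close> by \<open>lip_coeff_diag\<close>. Letting states and noise both vary serves
  the noise estimate as well as the induction for \<open>value_fun\<close>.\<close>

lemma step_lipschitz:
  assumes "j < n"
    and lip: "\<And>u u'. \<bar>g u - g u'\<bar> \<le> (\<Sum>i=1..n - j. lip_coeff j i * dist (u i) (u' i))"
  shows "\<bar>g (step (n - j) u y) - g (step (n - j) u' y')\<bar> \<le>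
      (\<Sum>i=1..<n - j. lip_coeff j i * dist (u i) (u' i)) +
      K j * dist (F (n - j) (hist (n - j) u) y) (F (n - j) (hist (n - j) u') y')"
proof -
  have split: "{1..n - j} = insert (n - j) {1..<n - j}" using assms by auto
  have "(\<Sum>i=1..n - j. lip_coeff j i * dist (step (n - j) u y i) (step (n - j) u' y' i)) =
      lip_coeff j (n - j) * dist (F (n - j) (hist (n - j) u) y) (F (n - j) (hist (n - j) u') y') +
      (\<Sum>i=1..<n - j. lip_coeff j i * dist (step (n - j) u y i) (step (n - j) u' y' i))"
    unfolding split by (subst sum.insert) (auto simp: step_def)
  also have "(\<Sum>i=1..<n - j. lip_coeff j i * dist (step (n - j) u y i) (step (n - j) u' y' i)) =
      (\<Sum>i=1..<n - j. lip_coeff j i * dist (u i) (u' i))"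
    by (intro sum.cong) (auto simp: step_def)
  finally show ?thesis
    using lip[of "step (n - j) u y" "step (n - j) u' y'"] lip_coeff_diag[of j] assms by simp
qed

text \<open>With equal states only the new coordinate moves, by at most \<open>dist y y'\<close>.
  This is the source of the factor \<open>K (n - k)\<close> in the \<open>k\<close>-th martingale
  difference.\<close>

lemma step_noise_lipschitz:
  assumes "j < n"
    and lip: "\<And>u u'. \<bar>g u - g u'\<bar> \<le> (\<Sum>i=1..n - j. lip_coeff j i * dist (u i) (u' i))"
  shows "\<bar>g (step (n - j) u y) - g (step (n - j) u y')\<bar> \<le> K j * dist y y'"
proof -
  have "K j * dist (F (n - j) (hist (n - j) u) y) (F (n - j) (hist (n - j) u) y') \<le> K j * dist y y'"
    using assms K_ge_1[of j] by (intro mult_left_mono F_lipschitz hist_in) auto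
  then show ?thesis
    using step_lipschitz[OF assms, of u y u y'] by simp
qed

text \<open>Average \<open>step_lipschitz\<close> over a common noise value: the contraction spreads
  the weight \<open>K j\<close> of the removed coordinate over the earlier ones, exactly as in
  \<open>lip_coeff_Suc\<close>.\<close>

lemma value_fun_lipschitz:
  "j \<le> n \<Longrightarrow> \<bar>value_fun j u - value_fun j u'\<bar> \<le> (\<Sum>i=1..n - j. lip_coeff j i * dist (u i) (u' i))"
proof (induction j arbitrary: u u')
  case 0
  show ?case
    using f_lipschitz[of "restrict u {1..n}" "restrict u' {1..n}"] by (simp add: lip_coeff_def)
next
  case (Suc j)
  define m where "m = n - j"
  have j: "j < n" and m: "m \<ge> 1" using Suc.prems by (auto simp: m_def)
  interpret prob_space "Q m" by (rule prob_space_Q)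
  note IH = Suc.IH[OF less_imp_le[OF j]]
  have Kj: "K j \<ge> 0" using K_ge_1[of j] by simp
  \<comment> \<open>A non-integrable function would get the default integral 0, and the two
    integrals could not be merged. The induction hypothesis gives integrability through the
    Lipschitz dependence on the noise.\<close>
  have int: "integrable (Q m) (\<lambda>y. value_fun j (step m u y))" for u
  proof (rule lipschitz_deviation(1)[OF prob_space_Q sets_Q _ Kj])
    show "\<bar>value_fun j (step m u y) - value_fun j (step m u y')\<bar> \<le> K j * dist y y'" for y y'
      unfolding m_def by (rule step_noise_lipschitz[OF j IH])
    show "AE y in Q m. mean_dist (Q m) y \<le> ennreal M"
      using m by (intro mean_dist_le) (auto simp: m_def)
  qed (use M_pos in simp)
  note con = F_hist_contraction[OF m, of u u']
  have "\<bar>value_fun (Suc j) u - value_fun (Suc j) u'\<bar> =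
      \<bar>\<integral>y. value_fun j (step m u y) - value_fun j (step m u' y) \<partial>Q m\<bar>"
    using int by (simp add: m_def)
  also have "\<dots> \<le> (\<integral>y. \<bar>value_fun j (step m u y) - value_fun j (step m u' y)\<bar> \<partial>Q m)"
    by (rule integral_abs_bound)
  also have "\<dots> \<le> (\<integral>y. (\<Sum>i=1..<m. lip_coeff j i * dist (u i) (u' i)) +
      K j * dist (F m (hist m u) y) (F m (hist m u') y) \<partial>Q m)"
  proof (rule integral_mono)
    show "integrable (Q m) (\<lambda>y. \<bar>value_fun j (step m u y) - value_fun j (step m u' y)\<bar>)"
      by (intro integrable_abs Bochner_Integration.integrable_diff int)
    show "integrable (Q m) (\<lambda>y. (\<Sum>i=1..<m. lip_coeff j i * dist (u i) (u' i)) +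
        K j * dist (F m (hist m u) y) (F m (hist m u') y))"
      using con(1) by simp
    show "\<bar>value_fun j (step m u y) - value_fun j (step m u' y)\<bar> \<le>
        (\<Sum>i=1..<m. lip_coeff j i * dist (u i) (u' i)) + K j * dist (F m (hist m u) y) (F m (hist m u') y)" for y
      unfolding m_def by (rule step_lipschitz[OF j IH])
  qed
  also have "\<dots> = (\<Sum>i=1..<m. lip_coeff j i * dist (u i) (u' i)) +
      K j * (\<integral>y. dist (F m (hist m u) y) (F m (hist m u') y) \<partial>Q m)"
    using con(1) by (simp add: prob_space)
  also have "\<dots> \<le> (\<Sum>i=1..<m. lip_coeff j i * dist (u i) (u' i)) +
      K j * (\<Sum>i=1..<m. a (m - i) * dist (u i) (u' i))"
    using con(2) Kj by (intro add_left_mono mult_left_mono)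
  also have "\<dots> = (\<Sum>i=1..<m. lip_coeff (Suc j) i * dist (u i) (u' i))"
    by (simp add: lip_coeff_Suc m_def[symmetric] sum_distrib_left sum.distrib[symmetric] algebra_simps)
  also have "{1..<m} = {1..n - Suc j}" using j by (auto simp: m_def)
  finally show ?case .
qed

lemma value_fun_step_lipschitz:
  assumes "j < n"
  shows "\<bar>value_fun j (step (n - j) u y) - value_fun j (step (n - j) u y')\<bar> \<le> K j * dist y y'"
  using assms value_fun_lipschitz by (intro step_noise_lipschitz) auto

text \<open>A Lipschitz bound in finitely many coordinates gives continuity in the product topology,
  whose Borel sets over countably many Polish factors form the product \<sigma>-algebra. The case
  \<open>j = 0\<close> makes \<open>f\<close> measurable along paths.\<close>

lemma value_fun_measurable:
  assumes "j \<le> n"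
  shows "value_fun j \<in> borel_measurable states"
proof -
  have "continuous_on UNIV (value_fun j)"
    unfolding continuous_on_def
  proof
    fix u :: "nat \<Rightarrow> 'x"
    have comp: "((\<lambda>u'. u' i) \<longlongrightarrow> u i) (at u)" for i
      using continuous_on_product_coordinates[of i] by (auto simp: continuous_on_def)
    have "((\<lambda>u'. \<Sum>i=1..n - j. lip_coeff j i * dist (u' i) (u i)) \<longlongrightarrow>
        (\<Sum>i=1..n - j. lip_coeff j i * dist (u i) (u i))) (at u)"
      by (intro tendsto_intros comp)
    then have "((\<lambda>u'. \<Sum>i=1..n - j. lip_coeff j i * dist (u' i) (u i)) \<longlongrightarrow> 0) (at u)"
      by simp
    then have "((\<lambda>u'. value_fun j u' - value_fun j u) \<longlongrightarrow> 0) (at u)"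
      by (rule Lim_null_comparison[rotated]) (use value_fun_lipschitz[OF assms] in simp)
    then show "(value_fun j \<longlongrightarrow> value_fun j u) (at u)"
      by (rule LIM_zero_cancel)
  qed
  then show ?thesis
    by (subst measurable_cong_sets[OF sets_PiM_equal_borel refl]) (rule borel_measurable_continuous_onI)
qed

lemma step_measurable:
  assumes "m \<ge> 1"
  shows "(\<lambda>(u, y). step m u y) \<in> measurable (states \<Otimes>\<^sub>M borel) states"
proof -
  have "(\<lambda>u. hist m u) \<in> measurable states (\<Pi>\<^sub>M i\<in>{1..}. borel)"
    unfolding hist_def by measurable
  then have "(\<lambda>(u, y). F m (hist m u) y) \<in> borel_measurable (states \<Otimes>\<^sub>M borel)"
    using measurable_compose[OF _ F_measurable[OF assms],
        of "\<lambda>p. (hist m (fst p), snd p)" "states \<Otimes>\<^sub>M borel"]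
    by (simp add: case_prod_beta' measurable_Pair measurable_compose[OF measurable_fst])
  then have [measurable]: "(\<lambda>p. F m (hist m (fst p)) (snd p)) \<in> borel_measurable (states \<Otimes>\<^sub>M borel)"
    by (simp add: case_prod_beta')
  have "(\<lambda>p i. if i = m then F m (hist m (fst p)) (snd p) else fst p i) \<in> measurable (states \<Otimes>\<^sub>M borel) states"
    by (rule measurable_abs_UNIV) measurable
  also have "(\<lambda>p i. if i = m then F m (hist m (fst p)) (snd p) else fst p i) = (\<lambda>(u, y). step m u y)"
    by (auto simp: step_def fun_eq_iff)
  finally show ?thesis .
qed

section \<open>Integration along the path\<close>

lemma path_measurable:
  "{1..k} \<subseteq> I \<Longrightarrow> path k \<in> measurable (Pi\<^sub>M I Q) states"
proof (induction k)
  case 0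
  show ?case by (simp add: space_PiM)
next
  case (Suc k)
  have [measurable]: "path k \<in> measurable (Pi\<^sub>M I Q) states"
    using Suc.prems by (intro Suc.IH) auto
  have "Suc k \<in> I" using Suc.prems by auto
  then have "(\<lambda>e. e (Suc k)) \<in> measurable (Pi\<^sub>M I Q) (Q (Suc k))"
    by (rule measurable_component_singleton)
  then have [measurable]: "(\<lambda>e. e (Suc k)) \<in> borel_measurable (Pi\<^sub>M I Q)"
    using measurable_cong_sets[OF refl sets_Q] by blast
  have "(\<lambda>e. (\<lambda>(u, y). step (Suc k) u y) (path k e, e (Suc k))) \<in> measurable (Pi\<^sub>M I Q) states"
    by (rule measurable_compose[OF _ step_measurable]) auto
  then show ?case by simp
qed

lemma path_cong: "(\<And>i. i \<in> {1..k} \<Longrightarrow> e i = e' i) \<Longrightarrow> path k e = path k e'"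
  by (induction k) auto

text \<open>Fubini with the last noise variable innermost; \<open>path k\<close> does not see the
  noise at \<open>Suc k\<close>.\<close>

lemma nn_integral_path_Suc:
  assumes "h \<in> borel_measurable states"
  shows "(\<integral>\<^sup>+ e. h (path (Suc k) e) \<partial>Pi\<^sub>M {1..Suc k} Q) =
    (\<integral>\<^sup>+ e. (\<integral>\<^sup>+ y. h (step (Suc k) (path k e) y) \<partial>Q (Suc k)) \<partial>Pi\<^sub>M {1..k} Q)"
proof -
  interpret product_sigma_finite Q
    using prob_space_Q by (simp add: product_sigma_finite_def prob_space_imp_sigma_finite)
  have [simp]: "path k (e(Suc k := y)) = path k e" for e y
    by (rule path_cong) auto
  have split: "{1..Suc k} = insert (Suc k) {1..k}" by auto
  have "(\<lambda>e. h (path (Suc k) e)) \<in> borel_measurable (Pi\<^sub>M (insert (Suc k) {1..k}) Q)"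
    unfolding split[symmetric] by (rule measurable_compose[OF path_measurable assms]) simp
  then show ?thesis
    unfolding split by (subst product_nn_integral_insert) auto
qed

lemma integral_path_Suc:
  fixes h :: "(nat \<Rightarrow> 'x) \<Rightarrow> real"
  assumes "integrable (Pi\<^sub>M {1..Suc k} Q) (\<lambda>e. h (path (Suc k) e))"
  shows "(\<integral>e. h (path (Suc k) e) \<partial>Pi\<^sub>M {1..Suc k} Q) =
    (\<integral>e. (\<integral>y. h (step (Suc k) (path k e) y) \<partial>Q (Suc k)) \<partial>Pi\<^sub>M {1..k} Q)"
proof -
  interpret product_sigma_finite Q
    using prob_space_Q by (simp add: product_sigma_finite_def prob_space_imp_sigma_finite)
  have [simp]: "path k (e(Suc k := y)) = path k e" for e y
    by (rule path_cong) auto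
  have split: "{1..Suc k} = insert (Suc k) {1..k}" by auto
  show ?thesis
    using assms unfolding split by (subst product_integral_insert) auto
qed

abbreviation "start \<equiv> \<lambda>_. X0 0"

text \<open>The tower property: the values along the path form a martingale started at
  \<open>value_fun n start\<close>. Integrability comes first, since Fubini for signed functions
  presupposes it.\<close>

lemma integral_value_fun_path:
  assumes "k \<le> n"
  shows "integrable (Pi\<^sub>M {1..k} Q) (\<lambda>e. value_fun (n - k) (path k e))"
    and "(\<integral>e. value_fun (n - k) (path k e) \<partial>Pi\<^sub>M {1..k} Q) = value_fun n start"
proof -
  have meas: "(\<lambda>e. value_fun (n - k) (path k e)) \<in> borel_measurable (Pi\<^sub>M {1..k} Q)" for k
    by (rule measurable_compose[OF path_measurable value_fun_measurable]) auto
  have prob: "prob_space (Pi\<^sub>M {1..k} Q)" for k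
    by (intro prob_space_PiM prob_space_Q)
  \<comment> \<open>Distances to the constant \<open>value_fun n start\<close> let nonnegative
    integrals carry the induction; each step adds at most \<open>K j * M\<close>.\<close>
  have fin: "(\<integral>\<^sup>+ e. ennreal \<bar>value_fun (n - k) (path k e) - value_fun n start\<bar> \<partial>Pi\<^sub>M {1..k} Q) < \<infinity>"
    if "k \<le> n" for k
    using that
  proof (induction k)
    case 0
    show ?case by simp
  next
    case (Suc k)
    define j where "j = n - Suc k"
    have j: "j < n" "n - j = Suc k" "n - k = Suc j" using Suc.prems by (auto simp: j_def)
    have Kj: "K j \<ge> 0" using K_ge_1[of j] by simp
    have k: "Suc k \<in> {1..n}" using Suc.prems by auto
    let ?W = "value_fun n start"
    have "(\<integral>\<^sup>+ e. ennreal \<bar>value_fun (n - Suc k) (path (Suc k) e) - ?W\<bar> \<partial>Pi\<^sub>M {1..Suc k} Q) =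
        (\<integral>\<^sup>+ e. (\<integral>\<^sup>+ y. ennreal \<bar>value_fun j (step (Suc k) (path k e) y) - ?W\<bar> \<partial>Q (Suc k)) \<partial>Pi\<^sub>M {1..k} Q)"
    proof -
      have [measurable]: "value_fun j \<in> borel_measurable states" using j by (intro value_fun_measurable) simp
      show ?thesis unfolding j_def[symmetric] by (rule nn_integral_path_Suc) measurable
    qed
    also have "\<dots> \<le> (\<integral>\<^sup>+ e. ennreal (K j * M) + ennreal \<bar>value_fun (n - k) (path k e) - ?W\<bar> \<partial>Pi\<^sub>M {1..k} Q)"
    proof (rule nn_integral_mono)
      fix e
      interpret Q: prob_space "Q (Suc k)" by (rule prob_space_Q)
      let ?g = "\<lambda>y. value_fun j (step (Suc k) (path k e) y)"
      \<comment> \<open>By the recursion of \<open>value_fun\<close>, the mean of \<open>?g\<close>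
        is \<open>value_fun (n - k) (path k e)\<close>, so this bounds one martingale
        difference.\<close>
      have "AE y in Q (Suc k). \<bar>?g y - (\<integral>y. ?g y \<partial>Q (Suc k))\<bar> \<le> K j * M"
        using value_fun_step_lipschitz[OF j(1)] j M_pos k
        by (intro lipschitz_deviation(3) prob_space_Q sets_Q Kj mean_dist_le) auto
      then have "AE y in Q (Suc k). ennreal \<bar>?g y - ?W\<bar> \<le>
          ennreal (K j * M) + ennreal \<bar>value_fun (n - k) (path k e) - ?W\<bar>"
      proof eventually_elim
        case (elim y)
        have "\<bar>?g y - ?W\<bar> \<le> K j * M + \<bar>value_fun (n - k) (path k e) - ?W\<bar>"
          using elim j by simp
        then show ?case
          using Kj M_pos by (simp add: ennreal_plus[symmetric] ennreal_leI del: ennreal_plus)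
      qed
      then have "(\<integral>\<^sup>+ y. ennreal \<bar>?g y - ?W\<bar> \<partial>Q (Suc k)) \<le>
          (\<integral>\<^sup>+ y. ennreal (K j * M) + ennreal \<bar>value_fun (n - k) (path k e) - ?W\<bar> \<partial>Q (Suc k))"
        by (rule nn_integral_mono_AE)
      also have "\<dots> = ennreal (K j * M) + ennreal \<bar>value_fun (n - k) (path k e) - ?W\<bar>"
        by (simp add: Q.emeasure_space_1)
      finally show "(\<integral>\<^sup>+ y. ennreal \<bar>?g y - ?W\<bar> \<partial>Q (Suc k)) \<le> \<dots>" .
    qed
    also have "\<dots> = ennreal (K j * M) +
        (\<integral>\<^sup>+ e. ennreal \<bar>value_fun (n - k) (path k e) - ?W\<bar> \<partial>Pi\<^sub>M {1..k} Q)"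
    proof -
      note [measurable] = meas[of k]
      have "(\<integral>\<^sup>+ e. ennreal (K j * M) + ennreal \<bar>value_fun (n - k) (path k e) - ?W\<bar> \<partial>Pi\<^sub>M {1..k} Q) =
          (\<integral>\<^sup>+ e. ennreal (K j * M) \<partial>Pi\<^sub>M {1..k} Q) +
          (\<integral>\<^sup>+ e. ennreal \<bar>value_fun (n - k) (path k e) - ?W\<bar> \<partial>Pi\<^sub>M {1..k} Q)"
        by (rule nn_integral_add) measurable
      then show ?thesis
        by (simp only: nn_integral_const prob_space.emeasure_space_1[OF prob] mult_1_right)
    qed
    also have "\<dots> < \<infinity>" using Suc by simp
    finally show ?case .
  qed
  have int: "integrable (Pi\<^sub>M {1..k} Q) (\<lambda>e. value_fun (n - k) (path k e))" if "k \<le> n" for k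
  proof -
    interpret prob_space "Pi\<^sub>M {1..k} Q" by (rule prob)
    have "integrable (Pi\<^sub>M {1..k} Q) (\<lambda>e. value_fun (n - k) (path k e) - value_fun n start)"
      using fin[OF that] meas[of k] by (intro integrableI_bounded) auto
    then have "integrable (Pi\<^sub>M {1..k} Q)
        (\<lambda>e. (value_fun (n - k) (path k e) - value_fun n start) + value_fun n start)"
      by (intro Bochner_Integration.integrable_add integrable_const)
    then show ?thesis by simp
  qed
  then show "integrable (Pi\<^sub>M {1..k} Q) (\<lambda>e. value_fun (n - k) (path k e))"
    using assms by blast
  show "(\<integral>e. value_fun (n - k) (path k e) \<partial>Pi\<^sub>M {1..k} Q) = value_fun n start"
    using assms
  proof (induction k)
    case 0
    show ?case using prob_space.prob_space[OF prob[of 0]] by simp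
  next
    case (Suc k)
    have k: "n - k = Suc (n - Suc k)" "n - (n - Suc k) = Suc k" using Suc.prems by auto
    have "(\<integral>e. value_fun (n - Suc k) (path (Suc k) e) \<partial>Pi\<^sub>M {1..Suc k} Q) =
        (\<integral>e. value_fun (n - k) (path k e) \<partial>Pi\<^sub>M {1..k} Q)"
      using integral_path_Suc[OF int[OF Suc.prems]] k by simp
    with Suc show ?case by simp
  qed
qed

section \<open>Exponential moments and the tail bound for the chain\<close>

text \<open>Given the first \<open>k\<close> noise variables, the factor of the past is constant and
  the next increment falls under \<open>lipschitz_mgf_le\<close>. All factors share
  \<open>t\<close>, \<open>w\<close> and \<open>C\<close>; only the variance term depends on
  \<open>i\<close>.\<close>

lemma mgf_path_le:
  assumes "k \<le> n" "t > 0" "w > 0" and C: "C > 0" "\<And>j. j < n \<Longrightarrow> K j * M \<le> C"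
  shows "(\<integral>\<^sup>+ e. ennreal (exp (t * ((value_fun (n - k) (path k e) - value_fun n start) / C))) \<partial>Pi\<^sub>M {1..k} Q)
    \<le> ennreal (\<Prod>i=1..k. two_point_mgf t w *
        exp (mgf_slope t w / two_point_mgf t w * ((K (n - i))\<^sup>2 * V i / C\<^sup>2 - w)))"
  using assms(1)
proof (induction k)
  case 0
  show ?case by (simp add: PiM_empty)
next
  case (Suc k)
  define j where "j = n - Suc k"
  have j: "j < n" "n - j = Suc k" "n - k = Suc j" using Suc.prems by (auto simp: j_def)
  have Kj: "K j \<ge> 0" using K_ge_1[of j] by simp
  have k: "Suc k \<in> {1..n}" using Suc.prems by auto
  let ?W = "value_fun n start"
  let ?b = "\<lambda>i. two_point_mgf t w *
        exp (mgf_slope t w / two_point_mgf t w * ((K (n - i))\<^sup>2 * V i / C\<^sup>2 - w))"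
  have b: "?b i \<ge> 0" for i using two_point_mgf_pos[of w t] assms by simp
  have [measurable]: "value_fun j \<in> borel_measurable states" using j by (intro value_fun_measurable) simp
  have [measurable]: "(\<lambda>e. value_fun (n - k) (path k e)) \<in> borel_measurable (Pi\<^sub>M {1..k} Q)"
    by (rule measurable_compose[OF path_measurable value_fun_measurable]) auto
  have "(\<integral>\<^sup>+ e. ennreal (exp (t * ((value_fun (n - Suc k) (path (Suc k) e) - ?W) / C))) \<partial>Pi\<^sub>M {1..Suc k} Q) =
      (\<integral>\<^sup>+ e. (\<integral>\<^sup>+ y. ennreal (exp (t * ((value_fun j (step (Suc k) (path k e) y) - ?W) / C))) \<partial>Q (Suc k)) \<partial>Pi\<^sub>M {1..k} Q)"
    unfolding j_def[symmetric] by (rule nn_integral_path_Suc) measurable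
  also have "\<dots> \<le> (\<integral>\<^sup>+ e. ennreal (exp (t * ((value_fun (n - k) (path k e) - ?W) / C))) * ennreal (?b (Suc k)) \<partial>Pi\<^sub>M {1..k} Q)"
  proof (rule nn_integral_mono)
    fix e
    let ?g = "\<lambda>y. value_fun j (step (Suc k) (path k e) y)"
    let ?c = "exp (t * ((value_fun (n - k) (path k e) - ?W) / C))"
    have lip: "\<bar>?g y - ?g y'\<bar> \<le> K j * dist y y'" for y y'
      using value_fun_step_lipschitz[OF j(1)] j by simp
    have [measurable]: "?g \<in> borel_measurable borel"
      using lipschitz_borel_measurable[OF lip Kj] .
    \<comment> \<open>The inner mean is the previous value, so the new increment is centred and
      splits off additively in the exponent.\<close>
    have mean: "(\<integral>y. ?g y \<partial>Q (Suc k)) = value_fun (n - k) (path k e)" using j by simp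
    have "(\<integral>\<^sup>+ y. ennreal (exp (t * ((?g y - ?W) / C))) \<partial>Q (Suc k)) =
        (\<integral>\<^sup>+ y. ennreal ?c * ennreal (exp (t * ((?g y - (\<integral>y. ?g y \<partial>Q (Suc k))) / C))) \<partial>Q (Suc k))"
      unfolding mean using C
      by (intro nn_integral_cong)
        (simp add: ennreal_mult[symmetric] exp_add[symmetric] distrib_left[symmetric] add_divide_distrib[symmetric])
    also have "\<dots> = ennreal ?c * (\<integral>\<^sup>+ y. ennreal (exp (t * ((?g y - (\<integral>y. ?g y \<partial>Q (Suc k))) / C))) \<partial>Q (Suc k))"
      by (rule nn_integral_cmult) measurable
    also have "\<dots> \<le> ennreal ?c * ennreal (?b (Suc k))"
      unfolding j_def[symmetric]
      by (intro mult_left_mono lipschitz_mgf_le[OF prob_space_Q sets_Q lip Kj, of M]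
          less_imp_le[OF M_pos] less_imp_le[OF V_pos] mean_dist_le mean_dist_sq_le k C j(1) assms) simp
    finally show "(\<integral>\<^sup>+ y. ennreal (exp (t * ((?g y - ?W) / C))) \<partial>Q (Suc k)) \<le> \<dots>" .
  qed
  also have "\<dots> = (\<integral>\<^sup>+ e. ennreal (exp (t * ((value_fun (n - k) (path k e) - ?W) / C))) \<partial>Pi\<^sub>M {1..k} Q) * ennreal (?b (Suc k))"
    by (rule nn_integral_multc) measurable
  also have "\<dots> \<le> ennreal (\<Prod>i=1..k. ?b i) * ennreal (?b (Suc k))"
    using Suc by (intro mult_right_mono) auto
  also have "\<dots> = ennreal (\<Prod>i=1..Suc k. ?b i)"
    using b by (subst ennreal_mult[symmetric]) (auto intro!: prod_nonneg)
  finally show ?case .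
qed

lemma path_deviation_le:
  assumes "x > 0"
  defines "VV \<equiv> (\<Sum>k=1..n. (K (n - k))\<^sup>2 * V k)"
  defines "S \<equiv> (\<lambda>e. f (restrict (path n e) {1..n}))"
  shows "measure (Pi\<^sub>M {1..n} Q) {e \<in> space (Pi\<^sub>M {1..n} Q). S e - (\<integral>e. S e \<partial>Pi\<^sub>M {1..n} Q) > x}
    \<le> H_bound n (x / (M * K (n - 1))) (sqrt VV / (M * K (n - 1)))"
proof -
  \<comment> \<open>One bound for all differences: \<open>diag_coeff\<close> is nondecreasing, so
    its largest value among the indices below \<open>n\<close> is at \<open>n - 1\<close>.\<close>
  define C where "C = M * K (n - 1)"
  interpret prob_space "Pi\<^sub>M {1..n} Q" by (intro prob_space_PiM prob_space_Q)
  have C: "C > 0" unfolding C_def using M_pos K_ge_1[of "n - 1"] by simp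
  have KC: "K j * M \<le> C" if "j < n" for j
    unfolding C_def using diag_coeff_mono[of a j "n - 1"] a_nonneg that M_pos by simp
  have VV: "VV > 0"
    unfolding VV_def using n_pos V_pos K_ge_1
    by (intro sum_pos mult_pos_pos zero_less_power) (auto intro: less_le_trans[OF zero_less_one])
  have S_eq: "S e = value_fun (n - n) (path n e)" for e by (simp add: S_def)
  have mean: "(\<integral>e. S e \<partial>Pi\<^sub>M {1..n} Q) = value_fun n start"
    unfolding S_eq by (rule integral_value_fun_path) simp
  have [measurable]: "S \<in> borel_measurable (Pi\<^sub>M {1..n} Q)"
    unfolding S_eq by (rule measurable_compose[OF path_measurable value_fun_measurable]) auto
  define E where "E = {e \<in> space (Pi\<^sub>M {1..n} Q). S e - value_fun n start > x}"
  have [measurable]: "E \<in> sets (Pi\<^sub>M {1..n} Q)" unfolding E_def by measurable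
  have sq: "(sqrt VV / C)\<^sup>2 = VV / C\<^sup>2" using VV by (simp add: power_divide)
  have "measure (Pi\<^sub>M {1..n} Q) E \<le> exp (- t * (x / C)) * two_point_mgf t ((sqrt VV / C)\<^sup>2 / n) ^ n"
    if t: "t > 0" for t
  proof -
    \<comment> \<open>The average of the normalised variance bounds
      \<open>(K (n - i))\<^sup>2 * V i / C\<^sup>2\<close>; this choice makes the correction
      exponents sum to 0.\<close>
    define w where "w = VV / C\<^sup>2 / n"
    have w: "w > 0" using VV C n_pos by (simp add: w_def)
    let ?A = "two_point_mgf t w"
    let ?c = "mgf_slope t w / two_point_mgf t w"
    have "emeasure (Pi\<^sub>M {1..n} Q) E = (\<integral>\<^sup>+ e. indicator E e \<partial>Pi\<^sub>M {1..n} Q)"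
      by (rule nn_integral_indicator[symmetric]) measurable
    \<comment> \<open>Markov's inequality in exponential form: on \<open>E\<close> the integrand is
      at least 1.\<close>
    also have "\<dots> \<le> (\<integral>\<^sup>+ e. ennreal (exp (- t * (x / C))) * ennreal (exp (t * ((S e - value_fun n start) / C))) \<partial>Pi\<^sub>M {1..n} Q)"
    proof (rule nn_integral_mono)
      fix e
      have "1 \<le> exp (- t * (x / C)) * exp (t * ((S e - value_fun n start) / C))" if "e \<in> E"
      proof -
        have "t * (x / C) \<le> t * ((S e - value_fun n start) / C)"
          using that t C by (intro mult_left_mono divide_right_mono) (auto simp: E_def)
        then show ?thesis by (simp add: exp_add[symmetric])
      qed
      then show "indicator E e \<le> ennreal (exp (- t * (x / C))) * ennreal (exp (t * ((S e - value_fun n start) / C)))"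
        by (auto simp: indicator_def ennreal_mult[symmetric] simp del: ennreal_1 simp flip: ennreal_1 intro!: ennreal_leI)
    qed
    also have "\<dots> = ennreal (exp (- t * (x / C))) * (\<integral>\<^sup>+ e. ennreal (exp (t * ((S e - value_fun n start) / C))) \<partial>Pi\<^sub>M {1..n} Q)"
      by (rule nn_integral_cmult) measurable
    also have "\<dots> \<le> ennreal (exp (- t * (x / C))) *
        ennreal (\<Prod>i=1..n. ?A * exp (?c * ((K (n - i))\<^sup>2 * V i / C\<^sup>2 - w)))"
      unfolding S_eq by (intro mult_left_mono mgf_path_le t w C KC) auto
    also have "(\<Prod>i=1..n. ?A * exp (?c * ((K (n - i))\<^sup>2 * V i / C\<^sup>2 - w))) =
        ?A ^ n * exp (\<Sum>i=1..n. ?c * ((K (n - i))\<^sup>2 * V i / C\<^sup>2 - w))"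
      by (simp add: prod.distrib exp_sum)
    also have "(\<Sum>i=1..n. ?c * ((K (n - i))\<^sup>2 * V i / C\<^sup>2 - w)) = ?c * (VV / C\<^sup>2 - n * w)"
      by (simp add: sum_distrib_left[symmetric] sum_subtractf sum_divide_distrib[symmetric] VV_def)
    also have "VV / C\<^sup>2 - n * w = 0" using n_pos by (simp add: w_def)
    finally have "emeasure (Pi\<^sub>M {1..n} Q) E \<le> ennreal (exp (- t * (x / C)) * ?A ^ n)"
      using two_point_mgf_pos[of w t] w by (simp add: ennreal_mult[symmetric])
    moreover have "0 \<le> exp (- t * (x / C)) * ?A ^ n"
      using two_point_mgf_pos[of w t] w by simp
    ultimately show ?thesis
      unfolding emeasure_eq_measure sq w_def by (simp only: ennreal_le_iff)
  qed
  then have "measure (Pi\<^sub>M {1..n} Q) E \<le> H_bound n (x / C) (sqrt VV / C)"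
    using n_pos assms C VV by (intro chernoff_le_H_bound) auto
  then show ?thesis unfolding E_def C_def mean .
qed

end

section \<open>Transfer to the given probability space\<close>

theorem proposition4p7:
  fixes P :: "'w measure"
    and \<epsilon> :: "nat \<Rightarrow> 'w \<Rightarrow> 'y::polish_space"
    and X :: "int \<Rightarrow> 'w \<Rightarrow> 'x::polish_space"
    and X0 :: "int \<Rightarrow> 'x"
    and F :: "nat \<Rightarrow> (nat \<Rightarrow> 'x) \<Rightarrow> 'y \<Rightarrow> 'x"
    and a :: "nat \<Rightarrow> real"
    and n :: nat
    and f :: "(nat \<Rightarrow> 'x) \<Rightarrow> real"
    and M :: real and V :: "nat \<Rightarrow> real" and x :: real
  defines "T \<equiv> (\<lambda>\<omega>. \<lambda>i\<in>{1..n}. X (int i) \<omega>)"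
  defines "S \<equiv> (\<lambda>\<omega>. f (T \<omega>) - (\<integral>\<omega>'. f (T \<omega>') \<partial>P))"
  defines "G \<equiv> (\<lambda>k. mean_dist (distr P borel (\<epsilon> k)))"
  defines "VV \<equiv> (\<Sum>k=1..n. (diag_coeff a (n - k))\<^sup>2 * V k)"
  assumes "prob_space P"
    and "prob_space.indep_vars P (\<lambda>_. borel) \<epsilon> {1..}"
    and "\<And>i \<omega>. i \<le> 0 \<Longrightarrow> \<omega> \<in> space P \<Longrightarrow> X i \<omega> = X0 i"
    and "\<And>m. m \<ge> 1 \<Longrightarrow>
      (\<lambda>(z, y). F m z y) \<in> measurable ((\<Pi>\<^sub>M i\<in>{1..}. borel) \<Otimes>\<^sub>M borel) borel"
    and "\<And>m \<omega>. m \<ge> 1 \<Longrightarrow> \<omega> \<in> space P \<Longrightarrow>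
      X (int m) \<omega> = F m (\<lambda>i\<in>{1..}. X (int m - int i) \<omega>) (\<epsilon> m \<omega>)"
    and "\<And>i. i \<ge> 1 \<Longrightarrow> a i \<ge> 0"
    and "summable (\<lambda>i. a (Suc i))" and "(\<Sum>i. a (Suc i)) < 1"
    and "\<And>m z z'. m \<ge> 1 \<Longrightarrow> z \<in> {1..} \<rightarrow>\<^sub>E UNIV \<Longrightarrow> z' \<in> {1..} \<rightarrow>\<^sub>E UNIV \<Longrightarrow>
      (\<integral>\<^sup>+ \<omega>. ennreal (dist (F m z (\<epsilon> m \<omega>)) (F m z' (\<epsilon> m \<omega>))) \<partial>P)
        \<le> (\<Sum>i. ennreal (a (Suc i) * dist (z (Suc i)) (z' (Suc i))))"
    and "n \<ge> 1"
    and "\<And>u u'. u \<in> {1..n} \<rightarrow>\<^sub>E UNIV \<Longrightarrow> u' \<in> {1..n} \<rightarrow>\<^sub>E UNIV \<Longrightarrow>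
      \<bar>f u - f u'\<bar> \<le> (\<Sum>i=1..n. dist (u i) (u' i))"
    and "\<And>m z y y'. m \<ge> 1 \<Longrightarrow> z \<in> {1..} \<rightarrow>\<^sub>E UNIV \<Longrightarrow>
      dist (F m z y) (F m z y') \<le> dist y y'"
    and "M > 0"
    and "\<And>k. k \<in> {1..n} \<Longrightarrow> V k > 0"
    and "\<And>k. k \<in> {1..n} \<Longrightarrow> AE \<omega> in P. G k (\<epsilon> k \<omega>) \<le> ennreal M"
    and "\<And>k. k \<in> {1..n} \<Longrightarrow> (\<integral>\<^sup>+ \<omega>. (G k (\<epsilon> k \<omega>))\<^sup>2 \<partial>P) \<le> ennreal (V k)"
    and "x > 0"
  shows "measure P {\<omega> \<in> space P. S \<omega> > x}
      \<le> H_bound n (x / (M * diag_coeff a (n - 1))) (sqrt VV / (M * diag_coeff a (n - 1))) \<and>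
    measure P {\<omega> \<in> space P. - S \<omega> > x}
      \<le> H_bound n (x / (M * diag_coeff a (n - 1))) (sqrt VV / (M * diag_coeff a (n - 1)))"
proof -
  interpret prob_space P by fact
  have \<epsilon>_meas [measurable]: "\<epsilon> i \<in> borel_measurable P" if "i \<ge> 1" for i
    using indep_vars_def2[THEN iffD1, OF assms(6)] that by auto
  \<comment> \<open>The product construction wants a probability measure at every index, also at 0,
    where nothing is known about \<open>\<epsilon>\<close>; \<open>max 1 i\<close> puts the law of
    \<open>\<epsilon> 1\<close> there.\<close>
  define Q where "Q = (\<lambda>i. distr P borel (\<epsilon> (max 1 i)))"
  have Q: "Q i = distr P borel (\<epsilon> i)" if "i \<ge> 1" for i
    using that by (simp add: Q_def max_def)
  have prob_Q: "prob_space (Q i)" for i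
    unfolding Q_def by (intro prob_space_distr \<epsilon>_meas) simp
  have nn_Q: "(\<integral>\<^sup>+ y. h y \<partial>Q m) = (\<integral>\<^sup>+ \<omega>. h (\<epsilon> m \<omega>) \<partial>P)"
    if "m \<ge> 1" "h \<in> borel_measurable borel" for m h
    unfolding Q[OF that(1)] by (rule nn_integral_distr[OF \<epsilon>_meas[OF that(1)]]) (use that in simp)
  have F_meas: "F m z \<in> borel_measurable borel" if "m \<ge> 1" "z \<in> {1..} \<rightarrow>\<^sub>E UNIV" for m z
  proof (rule borel_measurable_continuous_onI)
    have "1-lipschitz_on UNIV (F m z)"
      using assms(16)[OF that] by (intro lipschitz_onI) auto
    then show "continuous_on UNIV (F m z)" by (rule lipschitz_on_continuous_on)
  qed
  have contraction: "(\<integral>\<^sup>+ y. ennreal (dist (F m z y) (F m z' y)) \<partial>Q m)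
        \<le> (\<Sum>i. ennreal (a (Suc i) * dist (z (Suc i)) (z' (Suc i))))"
    if "m \<ge> 1" "z \<in> {1..} \<rightarrow>\<^sub>E UNIV" "z' \<in> {1..} \<rightarrow>\<^sub>E UNIV" for m z z'
  proof -
    note [measurable] = F_meas[OF that(1,2)] F_meas[OF that(1,3)]
    show ?thesis using assms(13)[OF that] by (subst nn_Q[OF that(1)]) measurable
  qed
  have G_Q: "G k = mean_dist (Q k)" if "k \<ge> 1" for k
    using Q[OF that] by (simp add: G_def)
  have G_meas: "mean_dist (Q k) \<in> borel_measurable borel" for k
    by (rule mean_dist_measurable[OF prob_Q]) (simp add: Q_def)
  \<comment> \<open>A general Lipschitz \<open>g\<close> is allowed so that both \<open>f\<close>
    and its negative are covered.\<close>
  have chain: "contractive_chain Q F a n g M V"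
    if "\<And>u u'. u \<in> {1..n} \<rightarrow>\<^sub>E UNIV \<Longrightarrow> u' \<in> {1..n} \<rightarrow>\<^sub>E UNIV \<Longrightarrow>
      \<bar>g u - g u'\<bar> \<le> (\<Sum>i=1..n. dist (u i) (u' i))" for g
  proof (rule contractive_chain.intro)
    fix k assume k: "k \<in> {1..n}"
    then have k1: "k \<ge> 1" by simp
    show "V k > 0" using assms(18) k .
    have "AE \<omega> in P. mean_dist (Q k) (\<epsilon> k \<omega>) \<le> ennreal M"
      using assms(19)[OF k] G_Q[OF k1] by simp
    then show "AE y in Q k. mean_dist (Q k) y \<le> ennreal M"
      using G_meas[of k] \<epsilon>_meas[OF k1] unfolding Q[OF k1] by (subst AE_distr_iff) auto
    show "(\<integral>\<^sup>+ y. (mean_dist (Q k) y)\<^sup>2 \<partial>Q k) \<le> ennreal (V k)"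
      using assms(20)[OF k] G_meas[of k] G_Q[OF k1] by (subst nn_Q[OF k1]) auto
  next
    show "sets (Q i) = sets borel" for i by (simp add: Q_def)
  qed (rule prob_Q assms(8) assms(10) contraction assms(16) that assms(17) assms(14); assumption)+
  let ?E = "\<lambda>\<omega>. \<lambda>i\<in>{1..n}. \<epsilon> i \<omega>"
  have E_meas: "?E \<in> measurable P (Pi\<^sub>M {1..n} Q)"
    by (intro measurable_restrict) (auto simp: Q)
  \<comment> \<open>Independence enters here: it makes the joint law of the noise a product.\<close>
  have distr_E: "distr P (Pi\<^sub>M {1..n} Q) ?E = Pi\<^sub>M {1..n} Q"
  proof -
    have "indep_vars (\<lambda>_. borel) \<epsilon> {1..n}"
      by (rule indep_vars_subset[OF assms(6)]) auto
    then have "distr P (Pi\<^sub>M {1..n} (\<lambda>_. borel)) ?E = Pi\<^sub>M {1..n} (\<lambda>i. distr P borel (\<epsilon> i))"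
      using assms(14) by (subst (asm) indep_vars_iff_distr_eq_PiM') auto
    also have "\<dots> = Pi\<^sub>M {1..n} Q"
      by (intro PiM_cong) (auto simp: Q)
    also have "distr P (Pi\<^sub>M {1..n} (\<lambda>_. borel)) ?E = distr P (Pi\<^sub>M {1..n} Q) ?E"
      by (intro distr_cong sets_PiM_cong) (auto simp: Q_def)
    finally show ?thesis .
  qed
  have tail: "measure P {\<omega> \<in> space P. g (T \<omega>) - (\<integral>\<omega>'. g (T \<omega>') \<partial>P) > x}
      \<le> H_bound n (x / (M * diag_coeff a (n - 1))) (sqrt VV / (M * diag_coeff a (n - 1)))"
    if g: "\<And>u u'. u \<in> {1..n} \<rightarrow>\<^sub>E UNIV \<Longrightarrow> u' \<in> {1..n} \<rightarrow>\<^sub>E UNIV \<Longrightarrow>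
      \<bar>g u - g u'\<bar> \<le> (\<Sum>i=1..n. dist (u i) (u' i))" for g
  proof -
    interpret C: contractive_chain Q F X0 a n g M V by (rule chain[OF g])
    let ?S = "\<lambda>e. g (restrict (C.path n e) {1..n})"
    \<comment> \<open>By induction over time: histories agree at positive times by the induction
      hypothesis, and at times up to 0 because \<open>X\<close> equals \<open>X0\<close>
      there.\<close>
    have path: "C.path k (?E \<omega>) i = X (int i) \<omega>"
      if "k \<le> n" "i \<in> {1..k}" and \<omega>: "\<omega> \<in> space P" for k i \<omega>
    proof -
      define e where "e = ?E \<omega>"
      have e: "e i = \<epsilon> i \<omega>" if "i \<in> {1..n}" for i
        using that by (simp add: e_def)
      have "C.path k e i = X (int i) \<omega>"
        using that(1,2)
      proof (induction k arbitrary: i)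
        case (Suc k)
        have "C.hist (Suc k) (C.path k e) = (\<lambda>i\<in>{1..}. X (int (Suc k) - int i) \<omega>)"
        proof
          fix i
          consider "i = 0" | "1 \<le> i" "i < Suc k" | "Suc k \<le> i" by linarith
          then show "C.hist (Suc k) (C.path k e) i = (\<lambda>i\<in>{1..}. X (int (Suc k) - int i) \<omega>) i"
          proof cases
            case 2
            then have "C.path k e (Suc k - i) = X (int (Suc k - i)) \<omega>"
              using Suc.prems by (intro Suc.IH) auto
            with 2 show ?thesis by (simp add: C.hist_def of_nat_diff)
          next
            case 3
            then show ?thesis
              using assms(7)[of "int (Suc k) - int i" \<omega>] \<omega> by (simp add: C.hist_def)
          qed (simp add: C.hist_def)
        qed
        then have "F (Suc k) (C.hist (Suc k) (C.path k e)) (e (Suc k)) = X (int (Suc k)) \<omega>"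
          using assms(9)[of "Suc k" \<omega>] \<omega> e[of "Suc k"] Suc.prems(1) by simp
        then show ?case
          using Suc.IH[of i] Suc.prems by (cases "i = Suc k") (auto simp: C.step_def)
      qed simp
      then show ?thesis by (simp add: e_def)
    qed
    have T: "T \<omega> = restrict (C.path n (?E \<omega>)) {1..n}" if "\<omega> \<in> space P" for \<omega>
      using path[OF order_refl _ that] by (auto simp: T_def restrict_def fun_eq_iff)
    define h where "h = (\<lambda>e. g (restrict (C.path n e) {1..n}))"
    \<comment> \<open>\<open>h\<close> is \<open>value_fun 0\<close> along the path.\<close>
    have h_meas [measurable]: "h \<in> borel_measurable (Pi\<^sub>M {1..n} Q)"
      using measurable_compose[OF C.path_measurable C.value_fun_measurable[of 0], of n "{1..n}"]
      by (simp add: h_def)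
    have gT: "g (T \<omega>) = h (?E \<omega>)" if "\<omega> \<in> space P" for \<omega>
      by (simp only: T[OF that] h_def)
    have "(\<integral>\<omega>. g (T \<omega>) \<partial>P) = (\<integral>\<omega>. h (?E \<omega>) \<partial>P)"
      by (rule Bochner_Integration.integral_cong[OF refl gT])
    also have "\<dots> = (\<integral>e. h e \<partial>distr P (Pi\<^sub>M {1..n} Q) ?E)"
      by (rule integral_distr[OF E_meas h_meas, symmetric])
    finally have mean: "(\<integral>\<omega>. g (T \<omega>) \<partial>P) = (\<integral>e. h e \<partial>Pi\<^sub>M {1..n} Q)"
      unfolding distr_E .
    define B where "B = {e \<in> space (Pi\<^sub>M {1..n} Q). h e - (\<integral>e. h e \<partial>Pi\<^sub>M {1..n} Q) > x}"
    have B_meas: "B \<in> sets (Pi\<^sub>M {1..n} Q)" unfolding B_def by measurable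
    have "measure P {\<omega> \<in> space P. g (T \<omega>) - (\<integral>\<omega>'. g (T \<omega>') \<partial>P) > x} = measure P (?E -` B \<inter> space P)"
    proof (rule arg_cong[where f = "measure P"], rule set_eqI)
      fix \<omega>
      show "\<omega> \<in> {\<omega> \<in> space P. g (T \<omega>) - (\<integral>\<omega>'. g (T \<omega>') \<partial>P) > x} \<longleftrightarrow> \<omega> \<in> ?E -` B \<inter> space P"
        unfolding mean B_def using gT[of \<omega>] measurable_space[OF E_meas, of \<omega>]
        by (cases "\<omega> \<in> space P") simp_all
    qed
    also have "\<dots> = measure (distr P (Pi\<^sub>M {1..n} Q) ?E) B"
      by (rule measure_distr[OF E_meas B_meas, symmetric])
    also have "\<dots> \<le> H_bound n (x / (M * diag_coeff a (n - 1))) (sqrt VV / (M * diag_coeff a (n - 1)))"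
      unfolding distr_E VV_def B_def h_def by (rule C.path_deviation_le) fact
    finally show ?thesis .
  qed
  \<comment> \<open>The lower tail is the upper tail of \<open>- f\<close>, which obeys the same
    Lipschitz bound.\<close>
  have "measure P {\<omega> \<in> space P. (- f (T \<omega>)) - (\<integral>\<omega>'. - f (T \<omega>') \<partial>P) > x}
      \<le> H_bound n (x / (M * diag_coeff a (n - 1))) (sqrt VV / (M * diag_coeff a (n - 1)))"
    by (rule tail) (use assms(15) in \<open>simp add: abs_minus_commute\<close>)
  moreover have "(- f (T \<omega>)) - (\<integral>\<omega>'. - f (T \<omega>') \<partial>P) = - S \<omega>" for \<omega>
    by (simp add: S_def)
  ultimately show ?thesis
    using tail[OF assms(15)] by (simp add: S_def)
qed

end
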